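(* Let $d_1,d_2,d_3\ge 2$. Let $(A_n)_{n\ge 1}$ be a sequence in $\mathbb{R}^{d_1\times d_2\times d_3}$ with $\operatorname{rank}_{\otimes}(A_n)\le 2$ for all $n$ and $\lim_{n\to\infty}A_n=A$, where the limit is taken in any norm topology. If $\operatorname{rank}_{\otimes}(A)>2$, then $\operatorname{rank}_{\otimes}(A)=3$ and there exist pairs of linearly independent vectors $\mathbf{x}_1,\mathbf{y}_1\in\mathbb{R}^{d_1}$, $\mathbf{x}_2,\mathbf{y}_2\in\mathbb{R}^{d_2}$, $\mathbf{x}_3,\mathbf{y}_3\in\mathbb{R}^{d_3}$ such that $$A=\mathbf{x}_1\otimes\mathbf{x}_2\otimes\mathbf{y}_3+\mathbf{x}_1\otimes\mathbf{y}_2\otimes\mathbf{x}_3+\mathbf{y}_1\otimes\mathbf{x}_2\otimes\mathbf{x}_3 .\qquad( * )$$ Furthermore, the result is not vacuous: for $A$ of the form $( * )$, with each pair $\mathbf{x}_i,\mathbf{y}_i$ linearly independent, $$A_n=n\Bigl(\mathbf{x}_1+\tfrac1n\mathbf{y}_1\Bigr)\otimes\Bigl(\mathbf{x}_2+\tfrac1n\mathbf{y}_2\Bigr)\otimes\Bigl(\mathbf{x}_3+\tfrac1n\mathbf{y}_3\Bigr)-n\,\mathbf{x}_1\otimes\mathbf{x}_2\otimes\mathbf{x}_3$$ is an example of a sequence of tensors with $\operatorname{rank}_\otimes(A_n)\le 2$ that converges to $A$.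
   Context: $\mathbb{R}^{d_1\times d_2\times d_3}\cong\mathbb{R}^{d_1}\otimes\mathbb{R}^{d_2}\otimes\mathbb{R}^{d_3}$ is the space of real 3-way arrays; $\mathbf{x}\otimes\mathbf{y}\otimes\mathbf{z}$ is the array with entries $x_iy_jz_k$, and such arrays are called decomposable. The outer-product rank $\operatorname{rank}_{\otimes}(A)$ is the least $r\ge 0$ such that $A$ is a sum of $r$ decomposable tensors. *)

theory Defs
  imports "HOL-Analysis.Analysis"
begin

type_synonym ('a, 'b, 'c) tensor3 = "real ^ 'c ^ 'b ^ 'a"

definition outer3 :: "real ^ 'a \<Rightarrow> real ^ 'b \<Rightarrow> real ^ 'c \<Rightarrow> ('a::finite, 'b::finite, 'c::finite) tensor3"
    (\<open>_ \<otimes> _ \<otimes> _\<close> [76, 76, 76] 75) where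
  "x \<otimes> y \<otimes> z = (\<chi> i j k. x $ i * y $ j * z $ k)"

definition decomposable :: "('a::finite, 'b::finite, 'c::finite) tensor3 \<Rightarrow> bool" where
  "decomposable D \<longleftrightarrow> (\<exists>x y z. D = x \<otimes> y \<otimes> z)"

definition sum_of_decomposables :: "nat \<Rightarrow> ('a::finite, 'b::finite, 'c::finite) tensor3 \<Rightarrow> bool" where
  "sum_of_decomposables r T \<longleftrightarrow>
     (\<exists>D :: nat \<Rightarrow> ('a, 'b, 'c) tensor3. (\<forall>i<r. decomposable (D i)) \<and> T = (\<Sum>i<r. D i))"

definition outer_rank :: "('a::finite, 'b::finite, 'c::finite) tensor3 \<Rightarrow> nat" where
  "outer_rank T = (LEAST r. sum_of_decomposables r T)"

text \<open>Every array is a sum of decomposables, so the minimum in \<^const>\<open>outer_rank\<close> is attained.\<close>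

lemma sum_of_decomposables_outer_rank:
  fixes T :: "('a::finite, 'b::finite, 'c::finite) tensor3"
  shows "sum_of_decomposables (outer_rank T) T"
proof -
  define F :: "'a \<times> 'b \<times> 'c \<Rightarrow> ('a, 'b, 'c) tensor3"
    where "F = (\<lambda>(i, j, k). (T $ i $ j $ k *\<^sub>R axis i 1) \<otimes> axis j 1 \<otimes> axis k 1)"
  have F: "F (i, j, k) $ i' $ j' $ k' =
      (if k = k' then if j = j' then if i = i' then T $ i $ j $ k else 0 else 0 else 0)"
    for i j k i' j' k'
    by (simp add: F_def outer3_def axis_def)
  have "(\<Sum>p\<in>UNIV. F p) = (\<Sum>i\<in>UNIV. \<Sum>j\<in>UNIV. \<Sum>k\<in>UNIV. F (i, j, k))"
    by (simp add: sum.cartesian_product)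
  then have "T = (\<Sum>p\<in>UNIV. F p)"
    by (simp add: vec_eq_iff F)
  moreover obtain h :: "nat \<Rightarrow> 'a \<times> 'b \<times> 'c"
    where "bij_betw h {0..<card (UNIV :: ('a \<times> 'b \<times> 'c) set)} UNIV"
    using ex_bij_betw_nat_finite[of "UNIV :: ('a \<times> 'b \<times> 'c) set"] by auto
  ultimately have "T = (\<Sum>i<card (UNIV :: ('a \<times> 'b \<times> 'c) set). F (h i))"
    by (simp add: sum.reindex_bij_betw lessThan_atLeast0)
  moreover have "decomposable (F p)" for p
    by (cases p) (auto simp: F_def decomposable_def)
  ultimately have "sum_of_decomposables (card (UNIV :: ('a \<times> 'b \<times> 'c) set)) T"
    unfolding sum_of_decomposables_def by (intro exI[of _ "\<lambda>i. F (h i)"]) blast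
  then show ?thesis
    unfolding outer_rank_def by (rule LeastI)
qed

text \<open>The disequality is needed because \<^prop>\<open>{x, y} = {x}\<close> when \<^prop>\<open>x = y\<close>.\<close>

definition lin_indep_pair :: "'v::real_vector \<Rightarrow> 'v \<Rightarrow> bool" where
  "lin_indep_pair x y \<longleftrightarrow> x \<noteq> y \<and> independent {x, y}"

text \<open>An arbitrary norm, as opposed to the Euclidean \<^const>\<open>norm\<close> fixed by the type class.\<close>

definition is_norm :: "('v::real_vector \<Rightarrow> real) \<Rightarrow> bool" where
  "is_norm N \<longleftrightarrow>
     (\<forall>x. 0 \<le> N x) \<and> (\<forall>x. N x = 0 \<longleftrightarrow> x = 0) \<and>
     (\<forall>c x. N (c *\<^sub>R x) = \<bar>c\<bar> * N x) \<and> (\<forall>x y. N (x + y) \<le> N x + N y)"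

definition tends_in_norm :: "('v::real_vector \<Rightarrow> real) \<Rightarrow> (nat \<Rightarrow> 'v) \<Rightarrow> 'v \<Rightarrow> bool" where
  "tends_in_norm N X L \<longleftrightarrow> (\<lambda>n. N (X n - L)) \<longlonglongrightarrow> 0"

end

theory Submission
  imports Defs
begin

text \<open>
  With respect to orthonormal frames \<open>(x, u)\<close>, \<open>(y, v)\<close>, \<open>(z, w)\<close> chosen so that the first of two
  decomposables is a multiple of \<open>x \<otimes> y \<otimes> z\<close>, a tensor of rank at most two becomes a
  \<open>2 \<times> 2 \<times> 2\<close> array which agrees with a rank-one array except in its corner entry. The minors
  avoiding that corner therefore vanish. Frames range over a compact set, so a limit of such
  tensors has the same property, and it has rank at most two unless the four entries with at least
  two indices outside the corner vanish and the three entries adjacent to the corner do not; this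
  is the form (*). Conversely, contracting (*) with dual bases gives a \<open>2 \<times> 2 \<times> 2\<close> array for which
  the determinant of the pencil of slices \<open>s M\<^sub>0 + t M\<^sub>1\<close> is \<open>- s\<^sup>2\<close>. For rank at most two it would be,
  up to a scalar, the product of the coefficients of the two summands, which are linear forms in
  \<open>(s, t)\<close>; both would then be multiples of \<open>s\<close>, contradicting \<open>M\<^sub>1 \<noteq> 0\<close>.
\<close>

section \<open>Algebra and continuity of the outer product\<close>

lemma outer3_add_left: "(x + x') \<otimes> y \<otimes> z = x \<otimes> y \<otimes> z + x' \<otimes> y \<otimes> z"
  and outer3_add_mid: "x \<otimes> (y + y') \<otimes> z = x \<otimes> y \<otimes> z + x \<otimes> y' \<otimes> z"
  and outer3_add_right: "x \<otimes> y \<otimes> (z + z') = x \<otimes> y \<otimes> z + x \<otimes> y \<otimes> z'"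
  and outer3_scaleR_left: "(c *\<^sub>R x) \<otimes> y \<otimes> z = c *\<^sub>R (x \<otimes> y \<otimes> z)"
  and outer3_scaleR_mid: "x \<otimes> (c *\<^sub>R y) \<otimes> z = c *\<^sub>R (x \<otimes> y \<otimes> z)"
  and outer3_scaleR_right: "x \<otimes> y \<otimes> (c *\<^sub>R z) = c *\<^sub>R (x \<otimes> y \<otimes> z)"
  by (simp_all add: outer3_def vec_eq_iff algebra_simps)

lemmas outer3_multilinear =
  outer3_add_left outer3_add_mid outer3_add_right
  outer3_scaleR_left outer3_scaleR_mid outer3_scaleR_right

text \<open>The triple sum factors. Contraction with decomposables thus reads off coordinates, both
  in orthonormal frames and against dual bases.\<close>

lemma inner_outer3: "(x \<otimes> y \<otimes> z) \<bullet> (x' \<otimes> y' \<otimes> z') = (x \<bullet> x') * (y \<bullet> y') * (z \<bullet> z')"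
proof -
  have "(x \<otimes> y \<otimes> z) \<bullet> (x' \<otimes> y' \<otimes> z') =
      (\<Sum>i\<in>UNIV. \<Sum>j\<in>UNIV. \<Sum>k\<in>UNIV. (x $ i * x' $ i) * ((y $ j * y' $ j) * (z $ k * z' $ k)))"
    by (simp add: inner_vec_def outer3_def mult_ac)
  also have "\<dots> = (x \<bullet> x') * ((y \<bullet> y') * (z \<bullet> z'))"
    by (simp add: inner_vec_def flip: sum_distrib_left sum_distrib_right)
  finally show ?thesis by simp
qed

lemma tendsto_outer3 [tendsto_intros]:
  assumes "(f \<longlongrightarrow> x) F" and "(g \<longlongrightarrow> y) F" and "(h \<longlongrightarrow> z) F"
  shows "((\<lambda>n. f n \<otimes> g n \<otimes> h n) \<longlongrightarrow> x \<otimes> y \<otimes> z) F"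
  unfolding outer3_def by (intro tendsto_intros assms)

section \<open>Rank bounds as explicit sums\<close>

lemma sum_of_decomposables_0: "sum_of_decomposables 0 T \<longleftrightarrow> T = 0"
  by (simp add: sum_of_decomposables_def)

lemma sum_of_decomposables_Suc:
  "sum_of_decomposables (Suc r) T \<longleftrightarrow> (\<exists>S x y z. sum_of_decomposables r S \<and> T = S + x \<otimes> y \<otimes> z)"
proof
  assume "sum_of_decomposables (Suc r) T"
  then obtain D where D: "\<forall>i<Suc r. decomposable (D i)" "T = (\<Sum>i<Suc r. D i)"
    unfolding sum_of_decomposables_def by blast
  then obtain x y z where "D r = x \<otimes> y \<otimes> z"
    unfolding decomposable_def by blast
  moreover have "sum_of_decomposables r (\<Sum>i<r. D i)"
    using D(1) unfolding sum_of_decomposables_def by (intro exI[of _ D]) simp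
  ultimately show "\<exists>S x y z. sum_of_decomposables r S \<and> T = S + x \<otimes> y \<otimes> z"
    using D(2) by auto
next
  assume "\<exists>S x y z. sum_of_decomposables r S \<and> T = S + x \<otimes> y \<otimes> z"
  then obtain D x y z where "\<forall>i<r. decomposable (D i)" "T = (\<Sum>i<r. D i) + x \<otimes> y \<otimes> z"
    unfolding sum_of_decomposables_def by blast
  then show "sum_of_decomposables (Suc r) T"
    unfolding sum_of_decomposables_def
    by (intro exI[of _ "D(r := x \<otimes> y \<otimes> z)"]) (auto simp: decomposable_def less_Suc_eq)
qed

text \<open>Padding with the decomposable \<open>0 \<otimes> 0 \<otimes> 0\<close> makes
  \<open>sum_of_decomposables\<close> monotone in the number of summands, so attaining the minimum
  is enough.\<close>

lemma outer_rank_le_iff: "outer_rank T \<le> r \<longleftrightarrow> sum_of_decomposables r T"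
proof
  have "sum_of_decomposables (Suc s) T" if "sum_of_decomposables s T" for s
  proof -
    have "T = T + 0 \<otimes> 0 \<otimes> 0"
      by (simp add: outer3_def vec_eq_iff)
    with that show ?thesis
      unfolding sum_of_decomposables_Suc by blast
  qed
  moreover assume "outer_rank T \<le> r"
  ultimately show "sum_of_decomposables r T"
    using lift_Suc_mono_le[of "\<lambda>s. sum_of_decomposables s T"] sum_of_decomposables_outer_rank[of T]
    by auto
next
  show "outer_rank T \<le> r" if "sum_of_decomposables r T"
    using that unfolding outer_rank_def by (rule Least_le)
qed

lemma outer_rank_le_2_iff:
  "outer_rank T \<le> 2 \<longleftrightarrow> (\<exists>x y z x' y' z'. T = x \<otimes> y \<otimes> z + x' \<otimes> y' \<otimes> z')"
  unfolding outer_rank_le_iff numeral_2_eq_2 sum_of_decomposables_Suc sum_of_decomposables_0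
  by (metis add_0)

lemma outer_rank_le_3:
  "outer_rank (x \<otimes> y \<otimes> z + x' \<otimes> y' \<otimes> z' + x'' \<otimes> y'' \<otimes> z'') \<le> 3"
  unfolding outer_rank_le_iff numeral_3_eq_3 sum_of_decomposables_Suc sum_of_decomposables_0
  by (metis add_0)

section \<open>Independent pairs and dual vectors\<close>

lemma lin_indep_pairI:
  fixes x y :: "'v::real_vector"
  assumes "\<And>a b. a *\<^sub>R x + b *\<^sub>R y = 0 \<Longrightarrow> a = 0 \<and> b = 0"
  shows "lin_indep_pair x y"
proof -
  have ne: "x \<noteq> y"
    using assms[of 1 "-1"] by auto
  have "y \<noteq> 0"
    using assms[of 0 1] by auto
  moreover have "x \<noteq> k *\<^sub>R y" for k
    using assms[of 1 "-k"] by auto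
  ultimately have "independent {x, y}"
    using ne by (auto simp: independent_insert span_singleton)
  with ne show ?thesis
    by (simp add: lin_indep_pair_def)
qed

text \<open>Values prescribed on an independent set extend to a linear functional \<open>g\<close>,
  and \<open>adjoint g 1\<close> is the vector representing it.\<close>

lemma lin_indep_pair_dual:
  fixes x y :: "'v::euclidean_space"
  assumes "lin_indep_pair x y"
  obtains p q where "p \<bullet> x = 1" "p \<bullet> y = 0" "q \<bullet> x = 0" "q \<bullet> y = 1"
proof -
  have ne: "x \<noteq> y" and ind: "independent {x, y}"
    using assms by (auto simp: lin_indep_pair_def)
  have *: "\<exists>p. \<forall>v\<in>{x, y}. p \<bullet> v = f v" for f :: "'v \<Rightarrow> real"
  proof -
    obtain g where g: "linear g" "\<forall>v\<in>{x, y}. g v = f v"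
      using linear_independent_extend[OF ind] by blast
    have "adjoint g 1 \<bullet> v = g v" for v
      using adjoint_works[OF g(1), of v 1] by (simp add: inner_commute)
    with g(2) show ?thesis by metis
  qed
  from *[of "\<lambda>v. if v = x then 1 else 0"] *[of "\<lambda>v. if v = x then 0 else 1"] ne that
  show ?thesis by fastforce
qed

section \<open>Comparison of an arbitrary norm with the Euclidean one\<close>

text \<open>\<open>N\<close> is Lipschitz for the Euclidean norm, hence attains a minimum on the
  compact unit sphere. It is positive by definiteness, and homogeneity carries the bound to all
  vectors. This half of the equivalence of norms turns convergence in \<open>N\<close> into
  Euclidean convergence.\<close>

lemma is_norm_bounded_below:
  fixes N :: "'v::euclidean_space \<Rightarrow> real"
  assumes "is_norm N"
  obtains c where "c > 0" "\<forall>x. c * norm x \<le> N x"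
proof -
  have nn: "0 \<le> N x" and z: "N x = 0 \<longleftrightarrow> x = 0" and sc: "N (a *\<^sub>R x) = \<bar>a\<bar> * N x"
    and tri: "N (x + y) \<le> N x + N y" for x y a
    using assms by (auto simp: is_norm_def)
  define B where "B = (\<Sum>b\<in>Basis. N b)"
  have N_sum: "N (\<Sum>b\<in>S. f b) \<le> (\<Sum>b\<in>S. N (f b))" if "finite S" for S and f :: "'v \<Rightarrow> 'v"
    using that
  proof induction
    case empty
    then show ?case using z[of 0] by simp
  next
    case (insert b S)
    then show ?case using tri[of "f b" "\<Sum>b\<in>S. f b"] by simp
  qed
  have le: "N x \<le> B * norm x" for x
  proof -
    have "N x = N (\<Sum>b\<in>Basis. (x \<bullet> b) *\<^sub>R b)"
      by (simp add: euclidean_representation)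
    also have "\<dots> \<le> (\<Sum>b\<in>Basis. \<bar>x \<bullet> b\<bar> * N b)"
      using N_sum[of Basis "\<lambda>b. (x \<bullet> b) *\<^sub>R b"] by (simp add: sc)
    also have "\<dots> \<le> (\<Sum>b\<in>Basis. norm x * N b)"
      by (intro sum_mono mult_right_mono nn) (rule Basis_le_norm)
    finally show ?thesis by (simp add: B_def sum_distrib_left mult.commute)
  qed
  have "B \<ge> 0" by (simp add: B_def nn sum_nonneg)
  have diff: "N x - N y \<le> B * norm (x - y)" for x y
    using tri[of "x - y" y] le[of "x - y"] by simp
  have "B-lipschitz_on UNIV N"
  proof (rule lipschitz_onI)
    show "dist (N x) (N y) \<le> B * dist x y" for x y
      using diff[of x y] diff[of y x] by (auto simp: dist_norm norm_minus_commute abs_le_iff)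
  qed fact
  then have cont: "continuous_on (sphere 0 1) N"
    using lipschitz_on_continuous_on continuous_on_subset by blast
  obtain b :: 'v where "norm b = 1"
    using vector_choose_size[of 1] by auto
  then have "sphere (0::'v) 1 \<noteq> {}" by auto
  then obtain s where s: "s \<in> sphere 0 1" "\<And>x. x \<in> sphere 0 1 \<Longrightarrow> N s \<le> N x"
    using continuous_attains_inf[OF compact_sphere _ cont] by blast
  have "s \<noteq> 0" using s(1) by auto
  then have "N s > 0" using nn[of s] z[of s] by linarith
  moreover have "N s * norm x \<le> N x" for x
  proof (cases "x = 0")
    case False
    then have "N s \<le> N (inverse (norm x) *\<^sub>R x)"
      by (intro s(2)) auto
    with False show ?thesis
      by (simp add: sc field_simps)
  qed (simp add: nn)
  ultimately show ?thesis using that by blast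
qed

lemma tends_in_norm_imp_tendsto:
  fixes X :: "nat \<Rightarrow> 'v::euclidean_space"
  assumes "is_norm N" and "tends_in_norm N X L"
  shows "X \<longlonglongrightarrow> L"
proof -
  obtain c where c: "c > 0" "\<forall>x. c * norm x \<le> N x"
    using is_norm_bounded_below[OF assms(1)] .
  have "(\<lambda>n. N (X n - L) / c) \<longlonglongrightarrow> 0"
    using assms(2) tendsto_divide_zero unfolding tends_in_norm_def by blast
  then have "(\<lambda>n. X n - L) \<longlonglongrightarrow> 0"
    by (rule Lim_null_comparison[rotated])
      (use c in \<open>simp add: field_simps\<close>)
  then show ?thesis by (simp add: LIM_zero_iff)
qed

section \<open>Frames adapted to a tensor of rank at most two\<close>

text \<open>Gram-Schmidt, including degenerate input: if \<open>a = 0\<close>, any unit vector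
  serves as \<open>x\<close>; if \<open>b\<close> is a multiple of \<open>x\<close>, the dimension
  bound supplies a direction orthogonal to \<open>x\<close> for \<open>u\<close>.\<close>

lemma orthonormal_frame:
  fixes a b :: "'v::euclidean_space"
  assumes "DIM('v) \<ge> 2"
  obtains x u \<alpha> p q where "norm x = 1" "norm u = 1" "x \<bullet> u = 0"
    "a = \<alpha> *\<^sub>R x" "b = p *\<^sub>R x + q *\<^sub>R u"
proof -
  have dir: "\<exists>x. norm x = 1 \<and> a = norm a *\<^sub>R x" for a :: 'v
  proof (cases "a = 0")
    case True
    then show ?thesis using vector_choose_size[of 1] by auto
  next
    case False
    then show ?thesis by (intro exI[of _ "sgn a"]) (simp add: norm_sgn sgn_div_norm)
  qed
  then obtain x where x: "norm x = 1" "a = norm a *\<^sub>R x" by blast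
  define w where "w = b - (b \<bullet> x) *\<^sub>R x"
  have xx: "x \<bullet> x = 1" using x(1) by (simp add: norm_eq_1)
  have wx: "x \<bullet> w = 0" by (simp add: w_def inner_diff_right xx inner_commute)
  obtain u where u: "norm u = 1" "x \<bullet> u = 0" "w = norm w *\<^sub>R u"
  proof (cases "w = 0")
    case True
    obtain v where "v \<noteq> 0" "orthogonal x v"
      using orthogonal_to_vector_exists[OF assms] by blast
    with True show ?thesis
      by (intro that[of "sgn v"]) (simp_all add: norm_sgn sgn_div_norm orthogonal_def)
  next
    case False
    with wx show ?thesis
      by (intro that[of "sgn w"]) (simp_all add: norm_sgn sgn_div_norm)
  qed
  have "b = (b \<bullet> x) *\<^sub>R x + norm w *\<^sub>R u"
    using u(3) by (simp add: w_def)
  with x u that show ?thesis by blast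
qed

text \<open>Frames are pairs, so that compactness and limits come from product spaces; boolean
  indices let sums over a frame expand by \<open>UNIV_bool\<close>. The corner has all indices
  \<open>False\<close>.\<close>

definition pair_nth :: "'v \<times> 'v \<Rightarrow> bool \<Rightarrow> 'v" where
  "pair_nth q i = (if i then snd q else fst q)"

definition basis3 ::
  "(real ^ 'a) \<times> (real ^ 'a) \<Rightarrow> (real ^ 'b) \<times> (real ^ 'b) \<Rightarrow> (real ^ 'c) \<times> (real ^ 'c) \<Rightarrow>
    bool \<Rightarrow> bool \<Rightarrow> bool \<Rightarrow> ('a::finite, 'b::finite, 'c::finite) tensor3" where
  "basis3 q r s i j k = pair_nth q i \<otimes> pair_nth r j \<otimes> pair_nth s k"

definition orthonormal_pair :: "'v::real_inner \<times> 'v \<Rightarrow> bool" where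
  "orthonormal_pair q \<longleftrightarrow> norm (fst q) = 1 \<and> norm (snd q) = 1 \<and> fst q \<bullet> snd q = 0"

text \<open>Minors that avoid the corner entry \<open>c False False False\<close>.\<close>

definition almost_rank_one :: "(bool \<Rightarrow> bool \<Rightarrow> bool \<Rightarrow> real) \<Rightarrow> bool" where
  "almost_rank_one c \<longleftrightarrow>
    c False True True * c True False True = c False False True * c True True True \<and>
    c False True True * c True True False = c False True False * c True True True \<and>
    c True False True * c True True False = c True False False * c True True True \<and>
    c False False True * c True True False = c False True False * c True False True \<and>
    c False True False * c True False True = c True False False * c False True True"

text \<open>Every clause is an equation between continuous functions of the tensor and the frames,
  so the condition is closed. The expansion confines \<open>T\<close> to the span of the eight frame
  tensors.\<close>

definition spanned ::
  "('a::finite, 'b::finite, 'c::finite) tensor3 \<Rightarrow>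
    (real ^ 'a) \<times> (real ^ 'a) \<Rightarrow> (real ^ 'b) \<times> (real ^ 'b) \<Rightarrow> (real ^ 'c) \<times> (real ^ 'c) \<Rightarrow> bool" where
  "spanned T q r s \<longleftrightarrow>
    orthonormal_pair q \<and> orthonormal_pair r \<and> orthonormal_pair s \<and>
    T = (\<Sum>i\<in>UNIV. \<Sum>j\<in>UNIV. \<Sum>k\<in>UNIV. (T \<bullet> basis3 q r s i j k) *\<^sub>R basis3 q r s i j k) \<and>
    almost_rank_one (\<lambda>i j k. T \<bullet> basis3 q r s i j k)"

lemma orthonormal_pair_inner_pair_nth:
  "orthonormal_pair q \<Longrightarrow> pair_nth q i \<bullet> pair_nth q j = (if i = j then 1 else 0)"
  by (auto simp: orthonormal_pair_def pair_nth_def norm_eq_1 inner_commute)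

text \<open>The frames make \<open>a\<close>, \<open>b\<close>, \<open>c\<close> multiples of
  \<open>x\<close>, \<open>y\<close>, \<open>z\<close>, so the first summand affects only the
  corner. All other coordinates are those of the second summand, hence products of one factor per
  index, and their minors vanish.\<close>

lemma exists_spanned:
  fixes T :: "('a::finite, 'b::finite, 'c::finite) tensor3"
  assumes "CARD('a) \<ge> 2" and "CARD('b) \<ge> 2" and "CARD('c) \<ge> 2"
    and "outer_rank T \<le> 2"
  shows "\<exists>q r s. spanned T q r s"
proof -
  obtain a b c a' b' c' where T: "T = a \<otimes> b \<otimes> c + a' \<otimes> b' \<otimes> c'"
    using assms(4) unfolding outer_rank_le_2_iff by blast
  have dim: "DIM(real ^ 'a) \<ge> 2" "DIM(real ^ 'b) \<ge> 2" "DIM(real ^ 'c) \<ge> 2"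
    using assms(1-3) by simp_all
  obtain x u \<alpha> p1 p2 where x: "norm x = 1" "norm u = 1" "x \<bullet> u = 0"
    "a = \<alpha> *\<^sub>R x" "a' = p1 *\<^sub>R x + p2 *\<^sub>R u"
    using orthonormal_frame[OF dim(1), of a a'] .
  obtain y v \<beta> q1 q2 where y: "norm y = 1" "norm v = 1" "y \<bullet> v = 0"
    "b = \<beta> *\<^sub>R y" "b' = q1 *\<^sub>R y + q2 *\<^sub>R v"
    using orthonormal_frame[OF dim(2), of b b'] .
  obtain z w \<gamma> r1 r2 where z: "norm z = 1" "norm w = 1" "z \<bullet> w = 0"
    "c = \<gamma> *\<^sub>R z" "c' = r1 *\<^sub>R z + r2 *\<^sub>R w"
    using orthonormal_frame[OF dim(3), of c c'] .
  define m where "m i j k = (if i then p2 else p1) * (if j then q2 else q1) * (if k then r2 else r1)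
      + (if i \<or> j \<or> k then 0 else \<alpha> * \<beta> * \<gamma>)" for i j k
  let ?q = "(x, u)" and ?r = "(y, v)" and ?s = "(z, w)"
  have on: "orthonormal_pair ?q" "orthonormal_pair ?r" "orthonormal_pair ?s"
    using x y z by (auto simp: orthonormal_pair_def)
  have T_eq: "T = (\<Sum>i\<in>UNIV. \<Sum>j\<in>UNIV. \<Sum>k\<in>UNIV. m i j k *\<^sub>R basis3 ?q ?r ?s i j k)"
    by (simp add: T x y z UNIV_bool basis3_def pair_nth_def m_def outer3_multilinear algebra_simps)
  \<comment> \<open>Orthonormality identifies the coefficients of the expansion with the inner
    products that \<open>spanned\<close> refers to.\<close>
  have m: "T \<bullet> basis3 ?q ?r ?s i j k = m i j k" for i j k
    by (cases i; cases j; cases k)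
      (simp_all add: T_eq UNIV_bool inner_add_left basis3_def inner_outer3
        orthonormal_pair_inner_pair_nth[OF on(1)] orthonormal_pair_inner_pair_nth[OF on(2)]
        orthonormal_pair_inner_pair_nth[OF on(3)])
  have "spanned T ?q ?r ?s"
    unfolding spanned_def m
    using on T_eq by (auto simp: almost_rank_one_def m_def)
  then show ?thesis by blast
qed

section \<open>Passage to the limit\<close>

lemma spanned_limit:
  fixes A :: "nat \<Rightarrow> ('a::finite, 'b::finite, 'c::finite) tensor3"
  assumes "\<And>n. spanned (A n) (q n) (r n) (s n)"
    and lim: "A \<longlonglongrightarrow> T" "q \<longlonglongrightarrow> q'" "r \<longlonglongrightarrow> r'" "s \<longlonglongrightarrow> s'"
  shows "spanned T q' r' s'"
proof -
  \<comment> \<open>Sequences that agree termwise have equal limits; each clause of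
    \<open>spanned\<close> is transferred by this fact.\<close>
  have eq: "l = l'" if "f \<longlonglongrightarrow> l" "g \<longlonglongrightarrow> l'" "\<And>n. f n = g n" for f g and l l' :: "'t::t2_space"
    using that LIMSEQ_unique by (metis ext)
  have nth: "(\<lambda>n. pair_nth (f n) i) \<longlonglongrightarrow> pair_nth l i"
    if "f \<longlonglongrightarrow> l" for f and l :: "'v::topological_space \<times> 'v" and i
    using tendsto_fst[OF that] tendsto_snd[OF that] by (cases i) (simp_all add: pair_nth_def)
  have orth: "orthonormal_pair l"
    if "f \<longlonglongrightarrow> l" "\<And>n. orthonormal_pair (f n)" for f and l :: "'v::real_inner \<times> 'v"
  proof -
    have "norm (fst l) = 1"
      by (rule eq[OF tendsto_norm[OF tendsto_fst[OF that(1)]] tendsto_const])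
        (use that(2) in \<open>simp add: orthonormal_pair_def\<close>)
    moreover have "norm (snd l) = 1"
      by (rule eq[OF tendsto_norm[OF tendsto_snd[OF that(1)]] tendsto_const])
        (use that(2) in \<open>simp add: orthonormal_pair_def\<close>)
    moreover have "fst l \<bullet> snd l = 0"
      by (rule eq[OF tendsto_inner[OF tendsto_fst[OF that(1)] tendsto_snd[OF that(1)]] tendsto_const])
        (use that(2) in \<open>simp add: orthonormal_pair_def\<close>)
    ultimately show ?thesis by (simp add: orthonormal_pair_def)
  qed
  have basis: "(\<lambda>n. basis3 (q n) (r n) (s n) i j k) \<longlonglongrightarrow> basis3 q' r' s' i j k" for i j k
    unfolding basis3_def by (intro tendsto_outer3 nth lim)
  have coeff: "(\<lambda>n. A n \<bullet> basis3 (q n) (r n) (s n) i j k) \<longlonglongrightarrow> T \<bullet> basis3 q' r' s' i j k" for i j k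
    by (intro tendsto_inner basis lim)
  have "orthonormal_pair q'" "orthonormal_pair r'" "orthonormal_pair s'"
    using assms(1) by (auto simp: spanned_def intro: orth[OF lim(2)] orth[OF lim(3)] orth[OF lim(4)])
  moreover have "T = (\<Sum>i\<in>UNIV. \<Sum>j\<in>UNIV. \<Sum>k\<in>UNIV. (T \<bullet> basis3 q' r' s' i j k) *\<^sub>R basis3 q' r' s' i j k)"
  proof (rule eq[OF lim(1)])
    show "(\<lambda>n. \<Sum>i\<in>UNIV. \<Sum>j\<in>UNIV. \<Sum>k\<in>UNIV.
        (A n \<bullet> basis3 (q n) (r n) (s n) i j k) *\<^sub>R basis3 (q n) (r n) (s n) i j k)
      \<longlonglongrightarrow> (\<Sum>i\<in>UNIV. \<Sum>j\<in>UNIV. \<Sum>k\<in>UNIV. (T \<bullet> basis3 q' r' s' i j k) *\<^sub>R basis3 q' r' s' i j k)"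
      by (intro tendsto_sum tendsto_scaleR coeff basis)
    show "A n = (\<Sum>i\<in>UNIV. \<Sum>j\<in>UNIV. \<Sum>k\<in>UNIV.
        (A n \<bullet> basis3 (q n) (r n) (s n) i j k) *\<^sub>R basis3 (q n) (r n) (s n) i j k)" for n
      using assms(1)[of n] unfolding spanned_def by blast
  qed
  moreover have "almost_rank_one (\<lambda>i j k. T \<bullet> basis3 q' r' s' i j k)"
  proof -
    have aro: "almost_rank_one (\<lambda>i j k. A n \<bullet> basis3 (q n) (r n) (s n) i j k)" for n
      using assms(1)[of n] unfolding spanned_def by blast
    note mult = tendsto_mult[OF coeff coeff]
    show ?thesis
      unfolding almost_rank_one_def
      by (intro conjI; rule eq[OF mult mult]) (use aro in \<open>simp_all add: almost_rank_one_def\<close>)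
  qed
  ultimately show ?thesis by (simp add: spanned_def)
qed

section \<open>Limit arrays of rank greater than two\<close>

text \<open>The entry \<open>d\<close> opposite the corner decides. If it is nonzero, the vanishing
  minors determine a rank-one array up to the corner, so the rank is at most two. If it is zero,
  they force \<open>d1\<close>, \<open>d2\<close>, \<open>d3\<close> to vanish, unless
  \<open>T\<close> is a vector times a two-by-two matrix, again of rank at most two.\<close>

lemma almost_rank_one_cases:
  fixes x u :: "real ^ 'a::finite" and y v :: "real ^ 'b::finite" and z w :: "real ^ 'c::finite"
  assumes "almost_rank_one c"
    and T: "T = (\<Sum>i\<in>UNIV. \<Sum>j\<in>UNIV. \<Sum>k\<in>UNIV. c i j k *\<^sub>R basis3 (x, u) (y, v) (z, w) i j k)"
    and "outer_rank T > 2"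
  obtains a b d e where "a \<noteq> 0" "b \<noteq> 0" "d \<noteq> 0"
    "T = x \<otimes> y \<otimes> (d *\<^sub>R w + e *\<^sub>R z) + x \<otimes> (b *\<^sub>R v) \<otimes> z + (a *\<^sub>R u) \<otimes> y \<otimes> z"
proof -
  define c0 c1 c2 c3 d1 d2 d3 d where defs:
    "c0 = c False False False" "c1 = c True False False" "c2 = c False True False"
    "c3 = c False False True" "d1 = c False True True" "d2 = c True False True"
    "d3 = c True True False" "d = c True True True"
  have rel: "d1 * d2 = c3 * d" "d1 * d3 = c2 * d" "d2 * d3 = c1 * d"
      "c3 * d3 = c2 * d2" "c2 * d2 = c1 * d1"
    using assms(1) by (simp_all add: almost_rank_one_def defs)
  have T_eq: "T = c0 *\<^sub>R (x \<otimes> y \<otimes> z) + c1 *\<^sub>R (u \<otimes> y \<otimes> z) + c2 *\<^sub>R (x \<otimes> v \<otimes> z) + c3 *\<^sub>R (x \<otimes> y \<otimes> w)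
      + d1 *\<^sub>R (x \<otimes> v \<otimes> w) + d2 *\<^sub>R (u \<otimes> y \<otimes> w) + d3 *\<^sub>R (u \<otimes> v \<otimes> z) + d *\<^sub>R (u \<otimes> v \<otimes> w)"
    by (simp add: T UNIV_bool basis3_def pair_nth_def defs algebra_simps)
  have no2: "T \<noteq> p \<otimes> q \<otimes> r + p' \<otimes> q' \<otimes> r'" for p q r p' q' r'
    using assms(3) outer_rank_le_2_iff[of T] by auto
  have "d = 0"
  proof (rule ccontr)
    assume "d \<noteq> 0"
    \<comment> \<open>The rank-one array is sought as \<open>d\<close> times the product of
      \<open>p *\<^sub>R x + u\<close>, \<open>q *\<^sub>R y + v\<close>,
      \<open>r *\<^sub>R z + w\<close>; the entries \<open>d1\<close>, \<open>d2\<close>,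
      \<open>d3\<close> fix the three ratios.\<close>
    define p q r where "p = d1 / d" "q = d2 / d" "r = d3 / d"
    have "d1 = p * d" "d2 = q * d" "d3 = r * d" "c1 = q * r * d" "c2 = p * r * d" "c3 = p * q * d"
      using \<open>d \<noteq> 0\<close> rel by (auto simp: p_q_r_def field_simps)
    \<comment> \<open>the entry left over in the corner\<close>
    moreover define k where "k = c0 - p * q * r * d"
    then have "c0 = k + p * q * r * d" by simp
    ultimately have "T = (k *\<^sub>R x) \<otimes> y \<otimes> z
        + (d *\<^sub>R (p *\<^sub>R x + u)) \<otimes> (q *\<^sub>R y + v) \<otimes> (r *\<^sub>R z + w)"
      by (simp add: T_eq outer3_multilinear algebra_simps)
    with no2 show False by blast
  qed
  \<comment> \<open>If the whole slice along \<open>u\<close> vanishes, then \<open>T\<close> is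
    \<open>x\<close> times a matrix with two rows. The other two directions are analogous.\<close>
  have 1: "\<not> (c1 = 0 \<and> d2 = 0 \<and> d3 = 0)"
  proof
    assume "c1 = 0 \<and> d2 = 0 \<and> d3 = 0"
    then have "T = x \<otimes> y \<otimes> (c0 *\<^sub>R z + c3 *\<^sub>R w) + x \<otimes> v \<otimes> (c2 *\<^sub>R z + d1 *\<^sub>R w)"
      using \<open>d = 0\<close> by (simp add: T_eq outer3_multilinear algebra_simps)
    with no2 show False by blast
  qed
  have 2: "\<not> (c2 = 0 \<and> d1 = 0 \<and> d3 = 0)"
  proof
    assume "c2 = 0 \<and> d1 = 0 \<and> d3 = 0"
    then have "T = x \<otimes> y \<otimes> (c0 *\<^sub>R z + c3 *\<^sub>R w) + u \<otimes> y \<otimes> (c1 *\<^sub>R z + d2 *\<^sub>R w)"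
      using \<open>d = 0\<close> by (simp add: T_eq outer3_multilinear algebra_simps)
    with no2 show False by blast
  qed
  have 3: "\<not> (c3 = 0 \<and> d1 = 0 \<and> d2 = 0)"
  proof
    assume "c3 = 0 \<and> d1 = 0 \<and> d2 = 0"
    then have "T = x \<otimes> (c0 *\<^sub>R y + c2 *\<^sub>R v) \<otimes> z + u \<otimes> (c1 *\<^sub>R y + d3 *\<^sub>R v) \<otimes> z"
      using \<open>d = 0\<close> by (simp add: T_eq outer3_multilinear algebra_simps)
    with no2 show False by blast
  qed
  \<comment> \<open>As \<open>d = 0\<close>, the products of any two of \<open>d1\<close>,
    \<open>d2\<close>, \<open>d3\<close> vanish. If \<open>d1\<close> were nonzero, then
    \<open>d2 = d3 = 0\<close>, and \<open>c1 * d1 = c2 * d2\<close> would give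
    \<open>c1 = 0\<close>, against fact \<open>1\<close>; similarly for \<open>d2\<close> and
    \<open>d3\<close>.\<close>
  have "d1 = 0 \<and> d2 = 0 \<and> d3 = 0"
    using rel 1 2 3 \<open>d = 0\<close> by auto
  then show ?thesis
    \<comment> \<open>The corner entry \<open>c0\<close> is absorbed into the last factor of the
      first summand.\<close>
    using that[of c1 c2 c3 c0] 1 2 3 \<open>d = 0\<close>
    by (simp add: T_eq outer3_multilinear algebra_simps)
qed

text \<open>Pairing a relation with \<open>u\<close> isolates \<open>b * d\<close>; pairing with
  \<open>x\<close> then gives \<open>a\<close>. The term in \<open>e\<close> accommodates the
  absorbed corner entry.\<close>

lemma orthonormal_lin_indep_pair:
  assumes "orthonormal_pair (x, u)" and "d \<noteq> 0"
  shows "lin_indep_pair x (d *\<^sub>R u + e *\<^sub>R x)"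
proof (rule lin_indep_pairI)
  fix a b
  assume "a *\<^sub>R x + b *\<^sub>R (d *\<^sub>R u + e *\<^sub>R x) = 0"
  then have 0: "(a *\<^sub>R x + b *\<^sub>R (d *\<^sub>R u + e *\<^sub>R x)) \<bullet> t = 0" for t
    by simp
  show "a = 0 \<and> b = 0"
    using 0[of x] 0[of u] assms
    by (auto simp: orthonormal_pair_def norm_eq_1 inner_add_left inner_commute[of u x])
qed

text \<open>Contracting the first index with \<open>f\<close> leaves, in the dual bases, a symmetric
  matrix with diagonal \<open>f \<bullet> y1\<close>, \<open>0\<close> and off-diagonal entry
  \<open>f \<bullet> x1\<close>, whose determinant is minus the square of
  \<open>f \<bullet> x1\<close>. Two summands would give
  \<open>(f \<bullet> a) * (f \<bullet> a') * D\<close> instead.\<close>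

lemma tangent_outer_rank:
  fixes x1 y1 :: "real ^ 'a::finite" and x2 y2 :: "real ^ 'b::finite" and x3 y3 :: "real ^ 'c::finite"
  assumes "lin_indep_pair x1 y1" and "lin_indep_pair x2 y2" and "lin_indep_pair x3 y3"
  shows "outer_rank (x1 \<otimes> x2 \<otimes> y3 + x1 \<otimes> y2 \<otimes> x3 + y1 \<otimes> x2 \<otimes> x3) > 2"
proof (rule ccontr)
  let ?T = "x1 \<otimes> x2 \<otimes> y3 + x1 \<otimes> y2 \<otimes> x3 + y1 \<otimes> x2 \<otimes> x3"
  assume "\<not> outer_rank ?T > 2"
  then obtain a b c a' b' c' where T: "?T = a \<otimes> b \<otimes> c + a' \<otimes> b' \<otimes> c'"
    using outer_rank_le_2_iff[of ?T] by (auto simp: not_less)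
  obtain p1 q1 where 1: "p1 \<bullet> x1 = 1" "p1 \<bullet> y1 = 0" "q1 \<bullet> x1 = 0" "q1 \<bullet> y1 = 1"
    using lin_indep_pair_dual[OF assms(1)] .
  obtain p2 q2 where 2: "p2 \<bullet> x2 = 1" "p2 \<bullet> y2 = 0" "q2 \<bullet> x2 = 0" "q2 \<bullet> y2 = 1"
    using lin_indep_pair_dual[OF assms(2)] .
  obtain p3 q3 where 3: "p3 \<bullet> x3 = 1" "p3 \<bullet> y3 = 0" "q3 \<bullet> x3 = 0" "q3 \<bullet> y3 = 1"
    using lin_indep_pair_dual[OF assms(3)] .
  define m where "m f g h = f \<bullet> a * (g \<bullet> b) * (h \<bullet> c) + f \<bullet> a' * (g \<bullet> b') * (h \<bullet> c')" for f g h
  have m: "m f g h = f \<bullet> x1 * (g \<bullet> x2) * (h \<bullet> y3) + f \<bullet> x1 * (g \<bullet> y2) * (h \<bullet> x3)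
      + f \<bullet> y1 * (g \<bullet> x2) * (h \<bullet> x3)" for f g h
    using arg_cong[OF T, of "\<lambda>S. (f \<otimes> g \<otimes> h) \<bullet> S"] by (simp add: m_def inner_add_right inner_outer3)
  \<comment> \<open>The contracted matrix factors through a diagonal one with entries
    \<open>f \<bullet> a\<close> and \<open>f \<bullet> a'\<close>; \<open>D\<close> is the product
    of the determinants of the two outer factors.\<close>
  define D where "D = (p2 \<bullet> b * (q2 \<bullet> b') - q2 \<bullet> b * (p2 \<bullet> b')) * (p3 \<bullet> c * (q3 \<bullet> c') - q3 \<bullet> c * (p3 \<bullet> c'))"
  \<comment> \<open>the polarized determinant of the slices, which vanishes on each single summand\<close>
  have det: "f \<bullet> a * (g \<bullet> a') * D + g \<bullet> a * (f \<bullet> a') * D =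
      m f p2 p3 * m g q2 q3 + m g p2 p3 * m f q2 q3 - m f p2 q3 * m g q2 p3 - m g p2 q3 * m f q2 p3" for f g
    unfolding D_def m_def by algebra
  have pp: "p1 \<bullet> a * (p1 \<bullet> a') * D = -1"
    using det[of p1 p1] by (simp add: m 1 2 3 mult_ac)
  have qq: "q1 \<bullet> a * (q1 \<bullet> a') * D = 0"
    using det[of q1 q1] by (auto simp: m 1 2 3)
  have pq: "p1 \<bullet> a * (q1 \<bullet> a') * D + q1 \<bullet> a * (p1 \<bullet> a') * D = 0"
    using det[of p1 q1] by (simp add: m 1 2 3)
  have "D \<noteq> 0" "p1 \<bullet> a \<noteq> 0" "p1 \<bullet> a' \<noteq> 0"
    using pp by auto
  \<comment> \<open>By \<open>qq\<close> one of the two numbers is zero, and \<open>pq\<close> then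
    makes the other zero. So contraction with \<open>q1\<close> kills both summands, although
    \<open>m q1 p2 p3\<close> equals \<open>1\<close>.\<close>
  with qq pq have "q1 \<bullet> a = 0 \<and> q1 \<bullet> a' = 0"
    by auto
  then have "m q1 p2 p3 = 0"
    by (simp add: m_def)
  then show False
    by (simp add: m 1 2 3)
qed

section \<open>The limit theorem for Euclidean convergence\<close>

lemma limit_of_rank_two:
  fixes A :: "nat \<Rightarrow> ('a::finite, 'b::finite, 'c::finite) tensor3"
  assumes "CARD('a) \<ge> 2" and "CARD('b) \<ge> 2" and "CARD('c) \<ge> 2"
    and "\<And>n. outer_rank (A n) \<le> 2" and "A \<longlonglongrightarrow> T" and "outer_rank T > 2"
  shows "\<exists>x1 y1 x2 y2 x3 y3.
    lin_indep_pair x1 y1 \<and> lin_indep_pair x2 y2 \<and> lin_indep_pair x3 y3 \<and>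
    T = x1 \<otimes> x2 \<otimes> y3 + x1 \<otimes> y2 \<otimes> x3 + y1 \<otimes> x2 \<otimes> x3"
proof -
  have "\<forall>n. \<exists>q r s. spanned (A n) q r s"
    using exists_spanned[OF assms(1-3)] assms(4) by blast
  then obtain q r s where sp: "\<And>n. spanned (A n) (q n) (r n) (s n)"
    by metis
  \<comment> \<open>Products of unit spheres already provide compactness; orthogonality of the limit
    frames comes from \<open>spanned_limit\<close>.\<close>
  define K where "K = ((sphere 0 1 \<times> sphere 0 1) \<times> (sphere 0 1 \<times> sphere 0 1) \<times> (sphere 0 1 \<times> sphere 0 1)
    :: (((real ^ 'a) \<times> (real ^ 'a)) \<times> ((real ^ 'b) \<times> (real ^ 'b)) \<times> ((real ^ 'c) \<times> (real ^ 'c))) set)"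
  have "compact K"
    unfolding K_def by (intro compact_Times compact_sphere)
  moreover have "(q n, r n, s n) \<in> K" for n
    using sp[of n] by (auto simp: K_def spanned_def orthonormal_pair_def mem_Times_iff)
  ultimately have "\<exists>l\<in>K. \<exists>\<sigma>. strict_mono \<sigma> \<and> ((\<lambda>n. (q n, r n, s n)) \<circ> \<sigma>) \<longlonglongrightarrow> l"
    unfolding compact_def by simp
  then obtain l \<sigma> where "strict_mono \<sigma>" and l: "((\<lambda>n. (q n, r n, s n)) \<circ> \<sigma>) \<longlonglongrightarrow> l"
    by blast
  have lim: "(q \<circ> \<sigma>) \<longlonglongrightarrow> fst l" "(r \<circ> \<sigma>) \<longlonglongrightarrow> fst (snd l)" "(s \<circ> \<sigma>) \<longlonglongrightarrow> snd (snd l)"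
    using tendsto_fst[OF l] tendsto_fst[OF tendsto_snd[OF l]] tendsto_snd[OF tendsto_snd[OF l]]
    by (simp_all add: o_def)
  have "(A \<circ> \<sigma>) \<longlonglongrightarrow> T"
    using LIMSEQ_subseq_LIMSEQ[OF assms(5) \<open>strict_mono \<sigma>\<close>] .
  then have spT: "spanned T (fst l) (fst (snd l)) (snd (snd l))"
    by (rule spanned_limit[OF _ _ lim, rotated]) (simp add: sp)
  obtain x u y v z w where "l = ((x, u), (y, v), (z, w))"
    by (cases l) auto
  with spT have on: "orthonormal_pair (x, u)" "orthonormal_pair (y, v)" "orthonormal_pair (z, w)"
    and aro: "almost_rank_one (\<lambda>i j k. T \<bullet> basis3 (x, u) (y, v) (z, w) i j k)"
    and T: "T = (\<Sum>i\<in>UNIV. \<Sum>j\<in>UNIV. \<Sum>k\<in>UNIV.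
      (T \<bullet> basis3 (x, u) (y, v) (z, w) i j k) *\<^sub>R basis3 (x, u) (y, v) (z, w) i j k)"
    by (simp_all add: spanned_def)
  obtain a b d e where "a \<noteq> 0" "b \<noteq> 0" "d \<noteq> 0" and
    T_eq: "T = x \<otimes> y \<otimes> (d *\<^sub>R w + e *\<^sub>R z) + x \<otimes> (b *\<^sub>R v) \<otimes> z + (a *\<^sub>R u) \<otimes> y \<otimes> z"
    using almost_rank_one_cases[OF aro T assms(6)] .
  then have "lin_indep_pair x (a *\<^sub>R u)" "lin_indep_pair y (b *\<^sub>R v)" "lin_indep_pair z (d *\<^sub>R w + e *\<^sub>R z)"
    using orthonormal_lin_indep_pair[OF on(1), of a 0] orthonormal_lin_indep_pair[OF on(2), of b 0]
      orthonormal_lin_indep_pair[OF on(3), of d e] by auto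
  with T_eq show ?thesis by blast
qed

section \<open>Convergence of the explicit sequence\<close>

text \<open>In the expanded product the terms of order \<open>n\<close> cancel and those of order
  one form the limit. The remainder is \<open>?S\<close> over \<open>n\<close> plus
  \<open>?Y\<close> over \<open>n\<close> squared, which the norm axioms bound directly.\<close>

lemma tangent_tends_in_norm:
  fixes x1 y1 :: "real ^ 'a::finite" and x2 y2 :: "real ^ 'b::finite" and x3 y3 :: "real ^ 'c::finite"
  assumes "is_norm N"
    and A: "\<And>n. n \<ge> 1 \<Longrightarrow> A n =
      real n *\<^sub>R ((x1 + (1 / real n) *\<^sub>R y1) \<otimes> (x2 + (1 / real n) *\<^sub>R y2) \<otimes> (x3 + (1 / real n) *\<^sub>R y3))
      - real n *\<^sub>R (x1 \<otimes> x2 \<otimes> x3)"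
  shows "tends_in_norm N A (x1 \<otimes> x2 \<otimes> y3 + x1 \<otimes> y2 \<otimes> x3 + y1 \<otimes> x2 \<otimes> x3)"
proof -
  let ?T = "x1 \<otimes> x2 \<otimes> y3 + x1 \<otimes> y2 \<otimes> x3 + y1 \<otimes> x2 \<otimes> x3"
  let ?S = "x1 \<otimes> y2 \<otimes> y3 + y1 \<otimes> x2 \<otimes> y3 + y1 \<otimes> y2 \<otimes> x3"
  let ?Y = "y1 \<otimes> y2 \<otimes> y3"
  have nn: "0 \<le> N x" and sc: "N (a *\<^sub>R x) = \<bar>a\<bar> * N x" and tri: "N (x + y) \<le> N x + N y" for x y a
    using assms(1) by (auto simp: is_norm_def)
  have le: "N (A n - ?T) \<le> 1 / real n * N ?S + 1 / real n * (1 / real n) * N ?Y" if "n \<ge> 1" for n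
  proof -
    define t where "t = 1 / real n"
    have t: "t \<ge> 0" "real n * t = 1"
      using that by (simp_all add: t_def)
    \<comment> \<open>Cancels the outer factor \<open>n\<close> against one factor \<open>t\<close>
      in each expanded term.\<close>
    have *: "real n *\<^sub>R t *\<^sub>R X = X" for X :: "('a, 'b, 'c) tensor3"
      using t(2) by simp
    have "A n - ?T = t *\<^sub>R ?S + (t * t) *\<^sub>R ?Y"
      unfolding A[OF that] t_def[symmetric]
      by (simp only: outer3_multilinear scaleR_add_right * scaleR_scaleR[symmetric]) (simp add: algebra_simps)
    then show ?thesis
      using tri[of "t *\<^sub>R ?S" "(t * t) *\<^sub>R ?Y"] t(1) unfolding t_def[symmetric] by (simp only: sc) simp
  qed
  have "(\<lambda>n. 1 / real n * N ?S + 1 / real n * (1 / real n) * N ?Y) \<longlonglongrightarrow> 0 * N ?S + 0 * 0 * N ?Y"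
    by (intro tendsto_intros lim_1_over_n)
  then have lim: "(\<lambda>n. 1 / real n * N ?S + 1 / real n * (1 / real n) * N ?Y) \<longlonglongrightarrow> 0"
    by (simp only: mult_zero_left add_0)
  show ?thesis
    unfolding tends_in_norm_def
  proof (rule tendsto_sandwich[OF _ _ tendsto_const lim])
    show "\<forall>\<^sub>F n in sequentially. 0 \<le> N (A n - ?T)"
      by (simp add: nn)
    show "\<forall>\<^sub>F n in sequentially. N (A n - ?T) \<le> 1 / real n * N ?S + 1 / real n * (1 / real n) * N ?Y"
      using eventually_ge_at_top[of 1] by eventually_elim (rule le)
  qed
qed

section \<open>Both directions for an arbitrary norm\<close>

theorem theorem1p1:
  fixes N :: "('a::finite, 'b::finite, 'c::finite) tensor3 \<Rightarrow> real"
  assumes "CARD('a) \<ge> 2" and "CARD('b) \<ge> 2" and "CARD('c) \<ge> 2"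
    and "is_norm N"
  shows "(\<forall>(A :: nat \<Rightarrow> ('a, 'b, 'c) tensor3) T.
            (\<forall>n\<ge>1. outer_rank (A n) \<le> 2) \<longrightarrow> tends_in_norm N A T \<longrightarrow> outer_rank T > 2 \<longrightarrow>
            outer_rank T = 3 \<and>
            (\<exists>x1 y1 x2 y2 x3 y3.
               lin_indep_pair x1 y1 \<and> lin_indep_pair x2 y2 \<and> lin_indep_pair x3 y3 \<and>
               T = x1 \<otimes> x2 \<otimes> y3 + x1 \<otimes> y2 \<otimes> x3 + y1 \<otimes> x2 \<otimes> x3))
       \<and> (\<forall>(x1 :: real ^ 'a) y1 (x2 :: real ^ 'b) y2 (x3 :: real ^ 'c) y3 T (A :: nat \<Rightarrow> ('a, 'b, 'c) tensor3).
            lin_indep_pair x1 y1 \<longrightarrow> lin_indep_pair x2 y2 \<longrightarrow> lin_indep_pair x3 y3 \<longrightarrow>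
            T = x1 \<otimes> x2 \<otimes> y3 + x1 \<otimes> y2 \<otimes> x3 + y1 \<otimes> x2 \<otimes> x3 \<longrightarrow>
            (\<forall>n\<ge>1. A n =
               real n *\<^sub>R ((x1 + (1 / real n) *\<^sub>R y1) \<otimes> (x2 + (1 / real n) *\<^sub>R y2) \<otimes> (x3 + (1 / real n) *\<^sub>R y3))
               - real n *\<^sub>R (x1 \<otimes> x2 \<otimes> x3)) \<longrightarrow>
            (\<forall>n\<ge>1. outer_rank (A n) \<le> 2) \<and> tends_in_norm N A T \<and> outer_rank T > 2)"
proof (intro conjI allI impI)
  fix A :: "nat \<Rightarrow> ('a, 'b, 'c) tensor3" and T
  assume rk: "\<forall>n\<ge>1. outer_rank (A n) \<le> 2" and lim: "tends_in_norm N A T" and T: "outer_rank T > 2"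
  \<comment> \<open>The rank bound says nothing about \<open>A 0\<close>; after the shift it holds
    at every index.\<close>
  have "(\<lambda>n. A (Suc n)) \<longlonglongrightarrow> T"
    using tends_in_norm_imp_tendsto[OF assms(4) lim] by (rule LIMSEQ_Suc)
  then show "\<exists>x1 y1 x2 y2 x3 y3.
      lin_indep_pair x1 y1 \<and> lin_indep_pair x2 y2 \<and> lin_indep_pair x3 y3 \<and>
      T = x1 \<otimes> x2 \<otimes> y3 + x1 \<otimes> y2 \<otimes> x3 + y1 \<otimes> x2 \<otimes> x3"
    using limit_of_rank_two[OF assms(1-3), of "\<lambda>n. A (Suc n)" T] rk T by simp
  then have "outer_rank T \<le> 3"
    using outer_rank_le_3 by blast
  with T show "outer_rank T = 3" by simp
next
  fix x1 y1 :: "real ^ 'a" and x2 y2 :: "real ^ 'b" and x3 y3 :: "real ^ 'c"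
    and T and A :: "nat \<Rightarrow> ('a, 'b, 'c) tensor3"
  assume ind: "lin_indep_pair x1 y1" "lin_indep_pair x2 y2" "lin_indep_pair x3 y3"
    and T: "T = x1 \<otimes> x2 \<otimes> y3 + x1 \<otimes> y2 \<otimes> x3 + y1 \<otimes> x2 \<otimes> x3"
    and A: "\<forall>n\<ge>1. A n =
      real n *\<^sub>R ((x1 + (1 / real n) *\<^sub>R y1) \<otimes> (x2 + (1 / real n) *\<^sub>R y2) \<otimes> (x3 + (1 / real n) *\<^sub>R y3))
      - real n *\<^sub>R (x1 \<otimes> x2 \<otimes> x3)"
  show "outer_rank (A n) \<le> 2" if "n \<ge> 1" for n
  proof -
    have "A n = (real n *\<^sub>R (x1 + (1 / real n) *\<^sub>R y1)) \<otimes> (x2 + (1 / real n) *\<^sub>R y2) \<otimes> (x3 + (1 / real n) *\<^sub>R y3)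
        + ((- real n) *\<^sub>R x1) \<otimes> x2 \<otimes> x3"
      using A that by (simp only: outer3_scaleR_left) simp
    then show ?thesis
      unfolding outer_rank_le_2_iff by blast
  qed
  show "tends_in_norm N A T"
    unfolding T using A by (intro tangent_tends_in_norm[OF assms(4)]) auto
  show "outer_rank T > 2"
    unfolding T using ind by (rule tangent_outer_rank)
qed

end
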